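(* Let $D$, $C$, $C'$, $C''$ be positive integers (the tensor dimensions being flattened), let $f:\mathbb{R}^{D\times C}\to\mathbb{R}^{C'}$ be an arbitrary function, let $r\in\mathbb{R}^{D\times C}$ be a fixed reference, let $x\in\mathbb{R}^{D\times C}$, and let $Z=\Omega(x,f)\in\mathbb{R}^{D\times C'}$ be the Shapley representation. For every matrix $A\in\mathbb{R}^{C''\times C'}$, the linear transform of $Z$ by $A$ is itself a Shapley transform for a modified function $\tilde f$: $$AZ^T= A\big(\Omega(x,f)\big)^T=\big(\Omega(x,\tilde f)\big)^T,$$ where $\tilde f:\mathbb{R}^{D\times C}\to\mathbb{R}^{C''}$ is given by $\tilde f(x)=A f(x)$.
   Context: A tensor $x\in\mathbb{R}^{D\times C}$ has rows $x_i\in\mathbb{R}^C$, $i=1,\dots,D$ (explainable index $i$; its $C$ channels are treated as one group). SHAP values with reference $r\in\mathbb{R}^{D\times C}$: for $z\in\{0,1\}^{D}$ let $\Psi_{x,r}(z)\in\mathbb{R}^{D\times C}$ be the tensor whose $i$-th row is $x_i$ if $z_i=1$ and $r_i$ if $z_i=0$. For a scalar function $f:\mathbb{R}^{D\times C}\to\mathbb{R}$ and $1\le i\le D$, $$\phi_i(f,x)=\frac1D\sum_{z\in\{0,1\}^{D},\,z_i=0}\binom{D-1}{\|z\|_1}^{-1}\Big[f\big(\Psi_{x,r}(z\cup\{i\})\big)-f\big(\Psi_{x,r}(z)\big)\Big],$$ where $\|z\|_1=\sum_i z_i$ and $z\cup\{i\}$ is $z$ with its $i$-th entry changed from $0$ to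 $1$. Shapley transform: for $f:\mathbb{R}^{D\times C}\to\mathbb{R}^{C'}$ with scalar outputs $f_j$, $\Omega(x,f)\in\mathbb{R}^{D\times C'}$ is defined by $[\Omega(x,f)]_{i,j}=\phi_i(f_j,x)$ for $1\le i\le D$, $1\le j\le C'$; the Shapley representation of $x$ is $Z=\Omega(x,f)$. The same reference $r$ is used for $f$ and $\tilde f$. *)

theory Defs
  imports "HOL-Analysis.Analysis"
begin

text \<open>
  A tensor with \<open>D\<close> rows and \<open>C\<close> channels is an element of \<^typ>\<open>real ^ 'c ^ 'd\<close> with
  \<open>CARD('d) = D\<close> and \<open>CARD('c) = C\<close>, so that \<open>x $ i\<close> is the whole group of channels at the
  explainable index \<open>i\<close>. A mask in \<open>{0,1}^D\<close> is represented by its support, a set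
  \<open>z :: 'd set\<close>; its 1-norm is then \<^term>\<open>card z\<close>, and switching entry \<open>i\<close> from 0 to 1 is
  \<^term>\<open>insert i z\<close>.
\<close>

definition mask_input :: "real ^ 'c ^ 'd \<Rightarrow> real ^ 'c ^ 'd \<Rightarrow> 'd set \<Rightarrow> real ^ 'c ^ 'd" where
  "mask_input r x z = (\<chi> i. if i \<in> z then x $ i else r $ i)"

definition shap_value ::
  "real ^ 'c ^ 'd \<Rightarrow> 'd \<Rightarrow> (real ^ 'c ^ 'd \<Rightarrow> real) \<Rightarrow> real ^ 'c ^ 'd \<Rightarrow> real" where
  "shap_value r i f x =
     1 / real CARD('d) *
       (\<Sum>z | i \<notin> z.
          inverse (real ((CARD('d) - 1) choose card z)) *
            (f (mask_input r x (insert i z)) - f (mask_input r x z)))"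

definition shapley_transform ::
  "real ^ 'c ^ 'd \<Rightarrow> real ^ 'c ^ 'd \<Rightarrow> (real ^ 'c ^ 'd \<Rightarrow> real ^ 'e) \<Rightarrow> real ^ 'e ^ 'd" where
  "shapley_transform r x f = (\<chi> i j. shap_value r i (\<lambda>y. f y $ j) x)"

end

theory Submission
  imports Defs
begin

text \<open>For fixed \<open>r\<close>, \<open>x\<close> and \<open>i\<close>, the SHAP value is a
  weighted sum of evaluations of the function at masked inputs, with points and weights independent
  of the function. It is thus a linear functional (\<open>shap_value_sum\<close>) and commutes with
  \<open>A\<close>, which only mixes output channels.\<close>

lemma shap_value_sum:
  fixes c :: "'k \<Rightarrow> real"
    and r x :: "real ^ 'c ^ 'd"
  shows "shap_value r i (\<lambda>y. \<Sum>k\<in>K. c k * g k y) x = (\<Sum>k\<in>K. c k * shap_value r i (g k) x)"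
proof -
  let ?w = "\<lambda>z :: 'd set. inverse (real ((CARD('d) - 1) choose card z))"
  let ?\<Delta> = "\<lambda>k z. g k (mask_input r x (insert i z)) - g k (mask_input r x z)"
  have "(\<Sum>z | i \<notin> z. ?w z * ((\<Sum>k\<in>K. c k * g k (mask_input r x (insert i z)))
            - (\<Sum>k\<in>K. c k * g k (mask_input r x z))))
      = (\<Sum>z | i \<notin> z. \<Sum>k\<in>K. c k * (?w z * ?\<Delta> k z))"
    by (simp add: sum_subtractf [symmetric] sum_distrib_left algebra_simps)
  \<comment> \<open>Masks and summands trade places; \<open>sum.swap\<close> asks for no finiteness,
    so \<open>K\<close> may be any set.\<close>
  also have "\<dots> = (\<Sum>k\<in>K. c k * (\<Sum>z | i \<notin> z. ?w z * ?\<Delta> k z))"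
    by (subst sum.swap) (simp add: sum_distrib_left)
  finally show ?thesis
    by (simp add: shap_value_def sum_distrib_left sum_divide_distrib)
qed

theorem lemma1:
  fixes f :: "real ^ 'c ^ 'd \<Rightarrow> real ^ 'e"
    and r x :: "real ^ 'c ^ 'd"
    and A :: "real ^ 'e ^ 'g"
  shows "A ** transpose (shapley_transform r x f)
       = transpose (shapley_transform r x (\<lambda>y. A *v f y))"
  \<comment> \<open>At entry \<open>(j, i)\<close>, linearity is applied with
    \<open>K = UNIV\<close>, coefficients \<open>A $ j $ k\<close> and functions
    \<open>f y $ k\<close>.\<close>
  by (simp add: vec_eq_iff matrix_matrix_mult_def matrix_vector_mult_def transpose_def
      shapley_transform_def shap_value_sum)

end
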